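(* Consider the distributed index coding problem with $n$ messages and side information sets $A_j \subseteq [n]\setminus\{j\}$, $j\in[n]$. Let $N$ be the set of nonempty subsets of $[n]$. For each $j \in [n]$ let $B_j = [n]\setminus (A_j\cup\{j\})$ be the set of interfering messages at receiver $j$. If the rate-capacity tuple $(\mathbf{R},\mathbf{C}) = ((R_j)_{j\in[n]}, (C_J)_{J\in N})$ is achievable, then for every $T \in N$ there exists a set function $f_T : 2^{T}\to\mathbb{R}$ such that $$R_j \le f_T\big((B_j\cup\{j\})\cap T\big) - f_T(B_j\cap T)\quad\text{for all } j\in T,$$ and 1. $f_T(\emptyset)=0$; 2. $f_T(T)=\sum_{J\in N:\, J\cap T\neq\emptyset} C_J$; 3. $f_T(A)\le f_T(B)$ for all $A\subseteq B\subseteq T$; 4. $f_T(A\cup B)+f_T(A\cap B)\le f_T(A)+f_T(B)$ for all $A,B\subseteq T$.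
   Context: Distributed index coding. $[n]=\{1,\dots,n\}$ and $N=\{J\subseteq[n] : J\neq\emptyset\}$. There are $n$ messages $x_j\in\{0,1\}^{t_j}$, $j\in[n]$ ($t_j$ nonnegative integers), and $n$ receivers; receiver $j$ wants $x_j$ and knows a priori the messages $x(A_j)=(x_i)_{i\in A_j}$, where $A_j\subseteq[n]\setminus\{j\}$. For each $J\in N$ there is a server holding exactly the messages $x_i$, $i\in J$; it broadcasts noiselessly to all receivers a sequence $y_J\in\{0,1\}^{u_J}$ ($u_J$ a nonnegative integer) that is a function of $(x_i)_{i\in J}$. Receiver $j$ must recover $x_j$ exactly as a function of $(y_J)_{J\in N}$ and $x(A_j)$, for every realization of the messages. A code consists of such lengths, encoding functions and decoding functions. With link capacities $C_J\ge 0$, the tuple $((R_j)_{j\in[n]},(C_J)_{J\in N})$ is achievable if there exist such a code and some $r>0$ with $R_j\le t_j/r$ for all $j\in[n]$ and $C_J\ge u_J/r$ for all $J\in N$. *)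

theory Defs
  imports Complex_Main "HOL-Library.FuncSet"
begin

definition messages :: "nat \<Rightarrow> nat set" where
  "messages n = {1..n}"

definition servers :: "nat \<Rightarrow> nat set set" where
  "servers n = {J. J \<subseteq> messages n \<and> J \<noteq> {}}"

definition bitstrings :: "nat \<Rightarrow> bool list set" where
  "bitstrings k = {w. length w = k}"

text \<open>
  \<open>tuples t K\<close> is the set of tuples \<open>(x\<^sub>i)\<close>, \<open>i \<in> K\<close>, with \<open>x\<^sub>i\<close> a bit string of length \<open>t i\<close>.
  Members are \<open>undefined\<close> off \<open>K\<close>, and for \<open>J \<subseteq> K\<close> the subtuple \<open>x(J)\<close> is \<open>restrict x J\<close>.
\<close>

definition tuples :: "('i \<Rightarrow> nat) \<Rightarrow> 'i set \<Rightarrow> ('i \<Rightarrow> bool list) set" where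
  "tuples t K = (\<Pi>\<^sub>E i\<in>K. bitstrings (t i))"

definition broadcast ::
  "nat \<Rightarrow> (nat set \<Rightarrow> (nat \<Rightarrow> bool list) \<Rightarrow> bool list) \<Rightarrow> (nat \<Rightarrow> bool list) \<Rightarrow> nat set \<Rightarrow> bool list" where
  "broadcast n enc x = (\<lambda>J\<in>servers n. enc J (restrict x J))"

definition index_code ::
  "nat \<Rightarrow> (nat \<Rightarrow> nat set) \<Rightarrow> (nat \<Rightarrow> nat) \<Rightarrow> (nat set \<Rightarrow> nat)
    \<Rightarrow> (nat set \<Rightarrow> (nat \<Rightarrow> bool list) \<Rightarrow> bool list)
    \<Rightarrow> (nat \<Rightarrow> (nat set \<Rightarrow> bool list) \<Rightarrow> (nat \<Rightarrow> bool list) \<Rightarrow> bool list) \<Rightarrow> bool" where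
  "index_code n A t u enc dec \<longleftrightarrow>
    (\<forall>J\<in>servers n. enc J \<in> tuples t J \<rightarrow> bitstrings (u J)) \<and>
    (\<forall>j\<in>messages n. dec j \<in> tuples u (servers n) \<rightarrow> tuples t (A j) \<rightarrow> bitstrings (t j)) \<and>
    (\<forall>x\<in>tuples t (messages n). \<forall>j\<in>messages n.
      dec j (broadcast n enc x) (restrict x (A j)) = x j)"

definition achievable ::
  "nat \<Rightarrow> (nat \<Rightarrow> nat set) \<Rightarrow> (nat \<Rightarrow> real) \<Rightarrow> (nat set \<Rightarrow> real) \<Rightarrow> bool" where
  "achievable n A R C \<longleftrightarrow>
    (\<exists>t u enc dec. \<exists>r::real. index_code n A t u enc dec \<and> r > 0 \<and>
      (\<forall>j\<in>messages n. R j \<le> real (t j) / r) \<and>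
      (\<forall>J\<in>servers n. C J \<ge> real (u J) / r))"

definition interfering :: "nat \<Rightarrow> (nat \<Rightarrow> nat set) \<Rightarrow> nat \<Rightarrow> nat set" where
  "interfering n A j = messages n - (A j \<union> {j})"

end

(*
  For independent uniform messages let Y be the part of the broadcast sent by the servers meeting T.
  The conditional entropy h(S) = H(Y | x_i, i not in S) vanishes at the empty set, is monotone and
  submodular, and satisfies h(T) <= sum of the u_J.  The increment of h in the rate inequality is
  the information on x_j contained in Y given the side information and the messages outside T;
  since these determine the rest of the broadcast, receiver j can decode from them and the
  increment is t_j.  To turn the bound on h(T)/r into an equality, the slack is added to h(S)/r for
  every nonempty S, which preserves monotonicity and submodularity.
*)
theory Submission
  imports Defs
begin

section \<open>Entropy of functions on a finite set\<close>

definition fibre :: "'a set \<Rightarrow> ('a \<Rightarrow> 'b) \<Rightarrow> 'a \<Rightarrow> 'a set" where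
  "fibre X g x = {y\<in>X. g y = g x}"

text \<open>Under the uniform distribution on \<open>X\<close>, the entropy of \<open>g\<close> is
  \<open>log 2 (card X) - log_fibres X g / card X\<close>.\<close>

definition log_fibres :: "'a set \<Rightarrow> ('a \<Rightarrow> 'b) \<Rightarrow> real" where
  "log_fibres X g = (\<Sum>x\<in>X. log 2 (card (fibre X g x)))"

lemma log_fibres_cong:
  assumes "\<And>x y. x \<in> X \<Longrightarrow> y \<in> X \<Longrightarrow> g x = g y \<longleftrightarrow> h x = h y"
  shows "log_fibres X g = log_fibres X h"
proof -
  have "fibre X g x = fibre X h x" if "x \<in> X" for x
    using assms that unfolding fibre_def by blast
  then show ?thesis by (simp add: log_fibres_def)
qed

lemma card_fibre_pos:
  assumes "finite X" "x \<in> X"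
  shows "card (fibre X g x) > 0"
  using assms by (auto simp: fibre_def card_gt_0_iff)

text \<open>Jensen's inequality for the concave logarithm, obtained by summing the tangent bound
  \<open>ln w \<le> w - 1\<close> at \<open>w = z x / c\<close>. It turns counting bounds on
  averages into entropy bounds.\<close>

lemma sum_log_le:
  fixes z :: "'a \<Rightarrow> real" and c :: real
  assumes pos: "\<And>x. x \<in> X \<Longrightarrow> z x > 0" and "c > 0" and le: "sum z X \<le> card X * c"
  shows "(\<Sum>x\<in>X. log 2 (z x)) \<le> card X * log 2 c"
proof -
  have "ln (z x) \<le> z x / c - 1 + ln c" if "x \<in> X" for x
    using ln_le_minus_one[of "z x / c"] pos[OF that] \<open>c > 0\<close> by (simp add: ln_div)
  then have "(\<Sum>x\<in>X. ln (z x)) \<le> (\<Sum>x\<in>X. z x / c - 1 + ln c)"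
    by (rule sum_mono)
  also have "\<dots> = sum z X / c - card X + card X * ln c"
    by (simp add: sum.distrib sum_subtractf sum_divide_distrib)
  also have "\<dots> \<le> card X * ln c"
    using le \<open>c > 0\<close> by (simp add: field_simps)
  finally have "(\<Sum>x\<in>X. ln (z x)) / ln 2 \<le> card X * ln c / ln 2"
    by (simp add: divide_right_mono)
  then show ?thesis
    by (simp add: log_def sum_divide_distrib)
qed

text \<open>The weights within one fibre add up to 1, so the sum counts the values taken by
  \<open>g\<close>.\<close>

lemma sum_inverse_fibre:
  assumes "finite X"
  shows "(\<Sum>x\<in>X. 1 / real (card (fibre X g x))) = card (g ` X)"
proof -
  have "(\<Sum>x | x \<in> X \<and> g x = b. 1 / real (card (fibre X g x))) = 1" if b: "b \<in> g ` X" for b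
  proof -
    have "fibre X g x = {x\<in>X. g x = b}" if "x \<in> X \<and> g x = b" for x
      using that by (auto simp: fibre_def)
    then have "(\<Sum>x | x \<in> X \<and> g x = b. 1 / real (card (fibre X g x)))
      = (\<Sum>x | x \<in> X \<and> g x = b. 1 / real (card {x\<in>X. g x = b}))"
      by (intro sum.cong) auto
    moreover have "card {x\<in>X. g x = b} \<noteq> 0"
      using b assms by auto
    ultimately show ?thesis by simp
  qed
  then show ?thesis
    by (simp add: sum.image_gen[OF assms, where g = g])
qed

text \<open>In entropy terms, H(f,g) \<le> H(f) + log |B|. By Jensen it suffices that the ratio of
  the fibre of \<open>f\<close> to the joint fibre is at most |B| on average.\<close>

lemma log_fibres_le_pair:
  assumes X: "finite X" and B: "finite B" and g: "g \<in> X \<rightarrow> B"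
  shows "log_fibres X f \<le> log_fibres X (\<lambda>x. (f x, g x)) + card X * log 2 (card B)"
proof (cases "X = {}")
  case True
  then show ?thesis by (simp add: log_fibres_def)
next
  case False
  let ?fg = "\<lambda>x. (f x, g x)"
  have "B \<noteq> {}" using False g by auto
  then have c: "real (card B) > 0" using B by (simp add: card_gt_0_iff)
  \<comment> \<open>Within one fibre of \<open>f\<close> the joint fibres are the fibres of
    \<open>g\<close>, so the sum counts values of \<open>g\<close> there.\<close>
  have fib: "(\<Sum>x\<in>fibre X f y. 1 / real (card (fibre X ?fg x))) \<le> card B" if "y \<in> X" for y
  proof -
    have "fibre X ?fg x = fibre (fibre X f y) g x" if "x \<in> fibre X f y" for x
      using that by (auto simp: fibre_def)
    then have "(\<Sum>x\<in>fibre X f y. 1 / real (card (fibre X ?fg x))) = card (g ` fibre X f y)"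
      using sum_inverse_fibre[of "fibre X f y" g] X by (simp add: fibre_def)
    moreover have "card (g ` fibre X f y) \<le> card B"
      using g by (intro card_mono[OF B]) (auto simp: fibre_def)
    ultimately show ?thesis by simp
  qed
  have "(\<Sum>x\<in>X. real (card (fibre X f x)) / card (fibre X ?fg x))
    = (\<Sum>x\<in>X. \<Sum>y | y \<in> X \<and> f y = f x. 1 / real (card (fibre X ?fg x)))"
    by (simp add: fibre_def)
  also have "\<dots> = (\<Sum>y\<in>X. \<Sum>x | x \<in> X \<and> f y = f x. 1 / real (card (fibre X ?fg x)))"
    by (rule sum.swap_restrict[OF X X])
  also have "\<dots> = (\<Sum>y\<in>X. \<Sum>x\<in>fibre X f y. 1 / real (card (fibre X ?fg x)))"
    by (simp add: fibre_def eq_commute)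
  also have "\<dots> \<le> (\<Sum>y\<in>X. real (card B))"
    by (rule sum_mono) (rule fib)
  finally have "(\<Sum>x\<in>X. real (card (fibre X f x)) / card (fibre X ?fg x)) \<le> card X * real (card B)"
    by simp
  then have "(\<Sum>x\<in>X. log 2 (real (card (fibre X f x)) / card (fibre X ?fg x)))
      \<le> card X * log 2 (card B)"
    using c by (intro sum_log_le) (auto simp: card_fibre_pos[OF X])
  moreover have "log 2 (real (card (fibre X f x)) / card (fibre X ?fg x))
      = log 2 (card (fibre X f x)) - log 2 (card (fibre X ?fg x))" if "x \<in> X" for x
    using card_fibre_pos[OF X that, of f] card_fibre_pos[OF X that, of ?fg]
    by (simp add: log_divide)
  ultimately show ?thesis
    by (simp add: log_fibres_def sum_subtractf)
qed

text \<open>Nonnegativity of the conditional mutual information I(p;q|m), where \<open>m\<close> is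
  a function of \<open>p\<close> and also of \<open>q\<close>: H(p) + H(q) \<ge> H(m) + H(p,q). By
  Jensen with constant 1, it suffices that \<open>P Q / (M PQ)\<close> averages to at most
  1.\<close>

lemma log_fibres_submodular:
  assumes X: "finite X"
    and p: "\<And>x y. x \<in> X \<Longrightarrow> y \<in> X \<Longrightarrow> p x = p y \<Longrightarrow> m x = m y"
    and q: "\<And>x y. x \<in> X \<Longrightarrow> y \<in> X \<Longrightarrow> q x = q y \<Longrightarrow> m x = m y"
  shows "log_fibres X p + log_fibres X q
    \<le> log_fibres X m + log_fibres X (\<lambda>x. (p x, q x))"
proof -
  define P Q M PQ where
    "P x = real (card (fibre X p x))" and "Q x = real (card (fibre X q x))" and
    "M x = real (card (fibre X m x))" and "PQ x = real (card (fibre X (\<lambda>x. (p x, q x)) x))" for x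
  note defs = P_def Q_def M_def PQ_def
  have pos: "P x > 0" "Q x > 0" "M x > 0" "PQ x > 0" if "x \<in> X" for x
    using card_fibre_pos[OF X that] by (auto simp: defs)
  \<comment> \<open>The \<open>x\<close> sharing \<open>p\<close> with \<open>y\<close> and
    \<open>q\<close> with \<open>z\<close> are either absent or form one joint fibre, whose size
    cancels \<open>PQ\<close>. In the latter case \<open>m y = m z\<close>, since \<open>m\<close>
    factors through both maps.\<close>
  have inner: "(\<Sum>x | x \<in> X \<and> p y = p x \<and> q z = q x. 1 / (M x * PQ x))
      \<le> (if m z = m y then 1 / M y else 0)" if "y \<in> X" "z \<in> X" for y z
  proof (cases "\<exists>x\<in>X. p y = p x \<and> q z = q x")
    case True
    then obtain x0 where x0: "x0 \<in> X" "p y = p x0" "q z = q x0" by blast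
    have eq: "{x. x \<in> X \<and> p y = p x \<and> q z = q x} = fibre X (\<lambda>x. (p x, q x)) x0"
      using x0 by (auto simp: fibre_def)
    have m: "m x0 = m y" "m z = m y"
      using p[OF that(1) x0(1)] q[OF that(2) x0(1)] x0 by auto
    have "M x = M y \<and> PQ x = PQ x0" if "x \<in> fibre X (\<lambda>x. (p x, q x)) x0" for x
    proof -
      have "x \<in> X" "p x = p x0" "q x = q x0" using that by (auto simp: fibre_def)
      with p[OF this(1) x0(1)] m show ?thesis by (simp add: defs fibre_def)
    qed
    then have "(\<Sum>x\<in>fibre X (\<lambda>x. (p x, q x)) x0. 1 / (M x * PQ x)) = PQ x0 * (1 / (M y * PQ x0))"
      by (simp add: PQ_def)
    also have "\<dots> = 1 / M y" using pos(4)[OF x0(1)] by simp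
    finally show ?thesis unfolding eq by (simp add: m)
  next
    case False
    then have "{x. x \<in> X \<and> p y = p x \<and> q z = q x} = {}" by blast
    then show ?thesis using pos(3)[OF that(1)] by (simp only: sum.empty) simp
  qed
  \<comment> \<open>\<open>P x\<close> and \<open>Q x\<close> are written as counts of
    \<open>y\<close> and \<open>z\<close>; exchanging the sums leaves \<open>inner\<close> for each
    pair.\<close>
  have "(\<Sum>x\<in>X. P x * Q x / (M x * PQ x))
    = (\<Sum>x\<in>X. \<Sum>y | y \<in> X \<and> p y = p x. \<Sum>z | z \<in> X \<and> q z = q x. 1 / (M x * PQ x))"
    by (simp add: P_def Q_def fibre_def)
  also have "\<dots> = (\<Sum>y\<in>X. \<Sum>x | x \<in> X \<and> p y = p x. \<Sum>z | z \<in> X \<and> q z = q x. 1 / (M x * PQ x))"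
    by (rule sum.swap_restrict[OF X X])
  also have "\<dots> = (\<Sum>y\<in>X. \<Sum>z\<in>X. \<Sum>x | x \<in> {x\<in>X. p y = p x} \<and> q z = q x. 1 / (M x * PQ x))"
    by (intro sum.cong sum.swap_restrict refl) (simp_all add: X)
  also have "\<dots> \<le> (\<Sum>y\<in>X. \<Sum>z\<in>X. if m z = m y then 1 / M y else 0)"
    using inner by (intro sum_mono) simp
  also have "\<dots> = (\<Sum>y\<in>X. 1)"
  proof (rule sum.cong[OF refl])
    fix y assume y: "y \<in> X"
    have "(\<Sum>z\<in>X. if m z = m y then 1 / M y else 0) = (\<Sum>z | z \<in> X \<and> m z = m y. 1 / M y)"
      by (simp add: sum.inter_filter[OF X, symmetric])
    also have "\<dots> = M y * (1 / M y)" by (simp add: M_def fibre_def)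
    finally show "(\<Sum>z\<in>X. if m z = m y then 1 / M y else 0) = 1" using pos(3)[OF y] by simp
  qed
  finally have le: "(\<Sum>x\<in>X. P x * Q x / (M x * PQ x)) \<le> card X * (1::real)"
    by simp
  have "(\<Sum>x\<in>X. log 2 (P x * Q x / (M x * PQ x))) \<le> card X * log 2 1"
    by (rule sum_log_le[OF _ _ le]) (auto simp: pos)
  moreover have "log 2 (P x * Q x / (M x * PQ x)) = log 2 (P x) + log 2 (Q x) - log 2 (M x) - log 2 (PQ x)"
    if "x \<in> X" for x
    using pos[OF that] by (simp add: log_divide log_mult)
  ultimately show ?thesis
    by (simp add: log_fibres_def sum_subtractf sum.distrib flip: defs)
qed

section \<open>Tuples of bit strings\<close>

lemma card_bitstrings: "card (bitstrings k) = 2 ^ k"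
  using card_lists_length_eq[of "UNIV :: bool set" k] by (simp add: bitstrings_def)

lemma finite_tuples: "finite K \<Longrightarrow> finite (tuples t K)"
  unfolding tuples_def
  by (rule finite_PiE) (simp_all add: card_bitstrings card_ge_0_finite)

lemma card_tuples: "finite K \<Longrightarrow> card (tuples t K) = 2 ^ sum t K"
  by (simp add: tuples_def card_PiE card_bitstrings power_sum)

lemma log_card_tuples: "finite K \<Longrightarrow> log 2 (card (tuples t K)) = real (sum t K)"
  by (simp add: card_tuples)

lemma restrict_in_tuples: "x \<in> tuples t K \<Longrightarrow> J \<subseteq> K \<Longrightarrow> restrict x J \<in> tuples t J"
  by (auto simp: tuples_def PiE_iff)

lemma restrict_eq_iff: "restrict x K = restrict y K \<longleftrightarrow> (\<forall>i\<in>K. x i = y i)"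
  by (auto simp: restrict_def fun_eq_iff)

section \<open>The conditional entropy of the broadcast\<close>

theorem theorem1:
  fixes n :: nat
    and A :: "nat \<Rightarrow> nat set"
    and R :: "nat \<Rightarrow> real"
    and C :: "nat set \<Rightarrow> real"
  assumes side_info: "\<And>j. j \<in> messages n \<Longrightarrow> A j \<subseteq> messages n - {j}"
    and capacities: "\<And>J. J \<in> servers n \<Longrightarrow> C J \<ge> 0"
    and achievable: "achievable n A R C"
  shows "\<forall>T\<in>servers n. \<exists>f :: nat set \<Rightarrow> real.
    (\<forall>j\<in>T. R j \<le> f ((interfering n A j \<union> {j}) \<inter> T) - f (interfering n A j \<inter> T)) \<and>
    f {} = 0 \<and>
    f T = (\<Sum>J | J \<in> servers n \<and> J \<inter> T \<noteq> {}. C J) \<and>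
    (\<forall>S S'. S \<subseteq> S' \<and> S' \<subseteq> T \<longrightarrow> f S \<le> f S') \<and>
    (\<forall>S S'. S \<subseteq> T \<and> S' \<subseteq> T \<longrightarrow> f (S \<union> S') + f (S \<inter> S') \<le> f S + f S')"
proof
  fix T assume T: "T \<in> servers n"
  obtain t u enc dec r where code: "index_code n A t u enc dec" and r: "r > 0"
    and R: "\<And>j. j \<in> messages n \<Longrightarrow> R j \<le> real (t j) / r"
    and C: "\<And>J. J \<in> servers n \<Longrightarrow> C J \<ge> real (u J) / r"
    using achievable unfolding achievable_def by blast
  define M where "M = messages n"
  define X where "X = tuples t M"
  define N where "N = {J \<in> servers n. J \<inter> T \<noteq> {}}"
  define Y where "Y x = (\<lambda>J\<in>N. enc J (restrict x J))" for x
  define V where "V S x = (restrict x (M - S), Y x)" for S x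
  \<comment> \<open>For S \<subseteq> M, H(V S) is
    \<open>sum t M - log_fibres X (V S) / card X\<close>. Subtracting the
    \<open>sum t (M - S)\<close> bits of the conditioning messages gives this formula for H(Y | x(M
    - S)).\<close>
  define h where "h S = real (sum t S) - log_fibres X (V S) / card X" for S
  have finM: "finite M" by (simp add: M_def messages_def)
  have "servers n \<subseteq> Pow M" by (auto simp: servers_def M_def)
  then have finN: "finite N"
    using finM by (auto simp: N_def intro: finite_subset)
  have TM: "T \<subseteq> M" "T \<noteq> {}" using T by (auto simp: servers_def M_def)
  have finX: "finite X" by (simp add: X_def finite_tuples finM)
  have cX: "real (card X) > 0" by (simp add: X_def card_tuples finM)
  have Y: "Y x \<in> tuples u N" if "x \<in> X" for x
    unfolding Y_def tuples_def
  proof (rule restrict_PiE_iff[THEN iffD2], rule ballI)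
    fix J assume "J \<in> N"
    then have "J \<in> servers n" "J \<subseteq> M" by (auto simp: N_def servers_def M_def)
    then show "enc J (restrict x J) \<in> bitstrings (u J)"
      using code restrict_in_tuples[OF that[unfolded X_def], of J] unfolding index_code_def by blast
  qed

  \<comment> \<open>Monotonicity, submodularity and an upper bound for the conditional
    entropy\<close>
  have h_empty: "h {} = 0"
  proof -
    have "fibre X (V {}) x = {x}" if "x \<in> X" for x
    proof -
      have "y = x" if "y \<in> X" "restrict y M = restrict x M" for y
        using that \<open>x \<in> X\<close> unfolding X_def tuples_def by (metis PiE_restrict)
      then show ?thesis using that by (auto simp: fibre_def V_def)
    qed
    then show ?thesis by (simp add: h_def log_fibres_def)
  qed

  have h_mono: "h S \<le> h S'" if S: "S \<subseteq> S'" "S' \<subseteq> T" for S S'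
  proof -
    have fin: "finite (S' - S)" "finite S'"
      using finite_subset[OF subset_trans[OF S(2) TM(1)] finM] by auto
    \<comment> \<open>\<open>V S\<close> amounts to \<open>V S'\<close> together with the messages
      in \<open>S' - S\<close>; these add at most \<open>sum t (S' - S)\<close> bits, which is
      exactly the change of the first term of \<open>h\<close>.\<close>
    let ?g = "\<lambda>x. restrict x (S' - S)"
    have "?g \<in> X \<rightarrow> tuples t (S' - S)"
      using S TM by (auto simp: X_def intro!: restrict_in_tuples)
    then have "log_fibres X (V S') \<le> log_fibres X (\<lambda>x. (V S' x, ?g x)) + card X * real (sum t (S' - S))"
      using log_fibres_le_pair[OF finX finite_tuples[OF fin(1)], of ?g t "V S'"]
      by (simp only: log_card_tuples fin)
    also have "log_fibres X (\<lambda>x. (V S' x, ?g x)) = log_fibres X (V S)"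
      using S TM by (intro log_fibres_cong) (auto simp: V_def restrict_eq_iff)
    finally have "log_fibres X (V S') / card X \<le> log_fibres X (V S) / card X + real (sum t (S' - S))"
      using cX by (simp add: field_simps)
    moreover have "sum t S' = sum t S + sum t (S' - S)"
      using sum.subset_diff[OF S(1) fin(2), of t] by simp
    ultimately show ?thesis by (simp add: h_def)
  qed

  have h_submod: "h (S \<union> S') + h (S \<inter> S') \<le> h S + h S'" if S: "S \<subseteq> T" "S' \<subseteq> T" for S S'
  proof -
    have fin: "finite S" "finite S'"
      using S finite_subset[OF TM(1) finM] by (auto intro: finite_subset)
    \<comment> \<open>\<open>V (S \<union> S')\<close> reveals only what \<open>V S\<close> and
      \<open>V S'\<close> both reveal of the messages, while the two together are equivalent to
      \<open>V (S \<inter> S')\<close>. The term \<open>sum t\<close> is modular.\<close>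
    have "log_fibres X (V S) + log_fibres X (V S')
        \<le> log_fibres X (V (S \<union> S')) + log_fibres X (\<lambda>x. (V S x, V S' x))"
      by (rule log_fibres_submodular[OF finX]) (auto simp: V_def restrict_eq_iff)
    also have "log_fibres X (\<lambda>x. (V S x, V S' x)) = log_fibres X (V (S \<inter> S'))"
      by (intro log_fibres_cong) (auto simp: V_def restrict_eq_iff)
    finally have "(log_fibres X (V S) + log_fibres X (V S')) / card X
        \<le> (log_fibres X (V (S \<union> S')) + log_fibres X (V (S \<inter> S'))) / card X"
      using cX by (simp add: divide_right_mono)
    moreover have "real (sum t (S \<union> S')) + real (sum t (S \<inter> S')) = real (sum t S) + real (sum t S')"
      using sum.union_inter[OF fin, of t] by (simp only: flip: of_nat_add)
    ultimately show ?thesis by (simp add: h_def add_divide_distrib del: of_nat_sum)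
  qed

  have h_T: "h T \<le> real (sum u N)"
  proof -
    let ?B = "tuples t (M - T) \<times> tuples u N"
    have finB: "finite ?B" using finM finN by (simp add: finite_tuples)
    have V: "V T \<in> X \<rightarrow> ?B"
      using Y by (auto simp: V_def X_def intro!: restrict_in_tuples)
    have "real (card ?B) = 2 ^ (sum t (M - T) + sum u N)"
      using finM finN by (simp add: card_cartesian_product card_tuples power_add)
    then have logB: "log 2 (card ?B) = real (sum t (M - T) + sum u N)"
      by (simp only:) simp
    \<comment> \<open>A constant map has entropy 0, so pairing it with \<open>V T\<close> bounds H(V
      T) by the logarithm of the size of \<open>?B\<close>.\<close>
    have "card X * real (sum t M) = log_fibres X (\<lambda>x. ())"
      using finM by (simp add: log_fibres_def fibre_def) (simp add: X_def log_card_tuples)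
    also have "\<dots> \<le> log_fibres X (\<lambda>x. ((), V T x)) + card X * real (sum t (M - T) + sum u N)"
      using log_fibres_le_pair[OF finX finB V, of "\<lambda>x. ()"] by (simp only: logB)
    also have "log_fibres X (\<lambda>x. ((), V T x)) = log_fibres X (V T)"
      by (intro log_fibres_cong) auto
    finally have "real (sum t M) \<le> log_fibres X (V T) / card X + real (sum t (M - T) + sum u N)"
      using cX by (simp add: field_simps)
    moreover have "sum t M = sum t T + sum t (M - T)"
      using sum.subset_diff[OF TM(1) finM, of t] by simp
    ultimately show ?thesis by (simp add: h_def)
  qed

  \<comment> \<open>Decodability and the rate increment\<close>
  have h_rate: "h ((interfering n A j \<union> {j}) \<inter> T) - h (interfering n A j \<inter> T) = t j"
    if j: "j \<in> T" for j
  proof -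
    let ?S = "interfering n A j \<inter> T"
    have jM: "j \<in> messages n" using j TM by (auto simp: M_def)
    have ins: "(interfering n A j \<union> {j}) \<inter> T = insert j ?S" using j by auto
    have jS: "j \<notin> ?S" by (simp add: interfering_def)
    have finS: "finite ?S" using finite_subset[OF TM(1) finM] by simp
    have decode: "x j = y j" if xy: "x \<in> X" "y \<in> X" and eq: "V (insert j ?S) x = V (insert j ?S) y" for x y
    proof -
      have agree: "x i = y i" if "i \<in> M" "i \<in> A j \<or> i \<notin> T" for i
      proof -
        have "i \<noteq> j" "i \<notin> ?S" using that side_info[OF jM] j by (auto simp: interfering_def)
        then show ?thesis using eq that by (auto simp: V_def restrict_eq_iff)
      qed
      have "restrict x (A j) = restrict y (A j)"
        using agree side_info[OF jM] by (auto simp: restrict_eq_iff M_def)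
      moreover have "enc J (restrict x J) = enc J (restrict y J)" if J: "J \<in> servers n" for J
      proof (cases "J \<in> N")
        case True
        then show ?thesis using eq by (auto simp: V_def Y_def restrict_eq_iff)
      next
        \<comment> \<open>A server outside \<open>N\<close> holds only messages outside
          \<open>T\<close>, on which \<open>x\<close> and \<open>y\<close> agree.\<close>
        case False
        then have "restrict x J = restrict y J"
          using J agree by (auto simp: restrict_eq_iff N_def M_def servers_def)
        then show ?thesis by simp
      qed
      then have "broadcast n enc x = broadcast n enc y"
        by (simp add: broadcast_def restrict_eq_iff)
      ultimately show ?thesis
        using code xy jM unfolding index_code_def X_def M_def by metis
    qed
    \<comment> \<open>As \<open>x j\<close> is already determined, revealing it does not split any
      fibre; only the term \<open>t j\<close> remains in the difference.\<close>
    have "V (insert j ?S) x = V (insert j ?S) y \<longleftrightarrow> V ?S x = V ?S y" if "x \<in> X" "y \<in> X" for x y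
      using decode[OF that] by (auto simp: V_def restrict_eq_iff)
    then have "log_fibres X (V (insert j ?S)) = log_fibres X (V ?S)"
      by (rule log_fibres_cong)
    then show ?thesis
      unfolding ins h_def using finS jS by simp
  qed

  \<comment> \<open>Scaling by \<open>r\<close> and correction of the value at
    \<open>T\<close>\<close>
  define d where "d = sum C N - h T / r"
  define f where "f S = (if S = {} then 0 else h S / r + d)" for S
  have "h T / r \<le> real (sum u N) / r"
    using h_T r by (simp add: divide_right_mono)
  also have "\<dots> = (\<Sum>J\<in>N. real (u J) / r)"
    by (simp add: sum_divide_distrib)
  also have "\<dots> \<le> sum C N"
    by (rule sum_mono) (simp add: C N_def)
  finally have d: "d \<ge> 0" by (simp add: d_def)
  have hr_mono: "h S / r \<le> h S' / r" if "S \<subseteq> S'" "S' \<subseteq> T" for S S'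
    using h_mono[OF that] r by (simp add: divide_right_mono)
  have f_mono: "f S \<le> f S'" if "S \<subseteq> S'" "S' \<subseteq> T" for S S'
    using hr_mono[OF that] hr_mono[of "{}" S'] that d by (auto simp: f_def h_empty)
  have f_submod: "f (S \<union> S') + f (S \<inter> S') \<le> f S + f S'" if "S \<subseteq> T" "S' \<subseteq> T" for S S'
  proof -
    have "(h (S \<union> S') + h (S \<inter> S')) / r \<le> (h S + h S') / r"
      using h_submod[OF that] r by (simp add: divide_right_mono)
    \<comment> \<open>Both sides contain \<open>d\<close> equally often, unless \<open>S\<close> and
      \<open>S'\<close> are nonempty and disjoint; then the right side has one more.\<close>
    then show ?thesis using d by (auto simp: f_def h_empty add_divide_distrib)
  qed
  have f_rate: "R j \<le> f ((interfering n A j \<union> {j}) \<inter> T) - f (interfering n A j \<inter> T)"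
    if j: "j \<in> T" for j
  proof -
    have "R j \<le> real (t j) / r" using R j TM by (auto simp: M_def)
    also have "\<dots> = h ((interfering n A j \<union> {j}) \<inter> T) / r - h (interfering n A j \<inter> T) / r"
      unfolding h_rate[OF j, symmetric] by (simp add: diff_divide_distrib)
    \<comment> \<open>The first set contains \<open>j\<close>, so \<open>d\<close> cancels, or is a
      gain when the second set is empty.\<close>
    also have "\<dots> \<le> f ((interfering n A j \<union> {j}) \<inter> T) - f (interfering n A j \<inter> T)"
      using d j by (auto simp: f_def h_empty)
    finally show ?thesis .
  qed
  have f_T: "f T = (\<Sum>J | J \<in> servers n \<and> J \<inter> T \<noteq> {}. C J)"
    using TM by (simp add: f_def d_def N_def)
  have "f {} = 0" by (simp add: f_def)
  with f_rate f_T f_mono f_submod show "\<exists>f :: nat set \<Rightarrow> real.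
    (\<forall>j\<in>T. R j \<le> f ((interfering n A j \<union> {j}) \<inter> T) - f (interfering n A j \<inter> T)) \<and>
    f {} = 0 \<and>
    f T = (\<Sum>J | J \<in> servers n \<and> J \<inter> T \<noteq> {}. C J) \<and>
    (\<forall>S S'. S \<subseteq> S' \<and> S' \<subseteq> T \<longrightarrow> f S \<le> f S') \<and>
    (\<forall>S S'. S \<subseteq> T \<and> S' \<subseteq> T \<longrightarrow> f (S \<union> S') + f (S \<inter> S') \<le> f S + f S')"
    by (intro exI[of _ f]) blast
qed

end
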